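(* Let $\mathfrak g$ be a vector space over $\mathbb K$. For $p\ge 0$ let $C^p(\mathfrak g,\mathfrak g)=\mathrm{Hom}(\wedge^p\mathfrak g\otimes\mathfrak g,\mathfrak g)$ and $C(\mathfrak g,\mathfrak g)=\bigoplus_{p\ge 0}C^p(\mathfrak g,\mathfrak g)$, where elements of $C^p(\mathfrak g,\mathfrak g)$ have degree $p$, and for $P\in C^p(\mathfrak g,\mathfrak g)$, $Q\in C^q(\mathfrak g,\mathfrak g)$ set $$[P,Q]^C=\frac{(p+q)!}{p!\,q!}\,\alpha\big([P,Q]^G\big),$$ where $\alpha$ is the alternator and $[\cdot,\cdot]^G$ the Gerstenhaber bracket. Then: (i) $(C(\mathfrak g,\mathfrak g),[\cdot,\cdot]^C)$ is a graded Lie algebra; (ii) $\pi\in\mathrm{Hom}(\otimes^2\mathfrak g,\mathfrak g)=C^1(\mathfrak g,\mathfrak g)$ defines a pre-Lie algebra structure on $\mathfrak g$ if and only if $[\pi,\pi]^C=0$.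
   Context: $\mathbb K$ is an algebraically closed field of characteristic $0$; vector spaces are finite dimensional over $\mathbb K$. A pre-Lie algebra is a vector space $\mathfrak g$ with a bilinear product $\cdot_{\mathfrak g}$ such that $(x\cdot_{\mathfrak g} y)\cdot_{\mathfrak g} z-x\cdot_{\mathfrak g}(y\cdot_{\mathfrak g} z)=(y\cdot_{\mathfrak g} x)\cdot_{\mathfrak g} z-y\cdot_{\mathfrak g}(x\cdot_{\mathfrak g} z)$ for all $x,y,z$. The map $\pi$ defines a pre-Lie algebra if $x\cdot_{\mathfrak g} y=\pi(x,y)$ is such a product. Let $A^p(\mathfrak g,\mathfrak g)=\mathrm{Hom}(\otimes^{p+1}\mathfrak g,\mathfrak g)$ (degree $p$), $A(\mathfrak g,\mathfrak g)=\bigoplus_{p\ge0}A^p(\mathfrak g,\mathfrak g)$. For $P\in A^p(\mathfrak g,\mathfrak g)$, $Q\in A^q(\mathfrak g,\mathfrak g)$ define $P\circ Q\in A^{p+q}(\mathfrak g,\mathfrak g)$ by $$P\circ Q(x_1,\ldots,x_{p+q+1})=\sum_{i=1}^{p+1}(-1)^{(i-1)q}P(x_1,\ldots,x_{i-1},Q(x_i,\ldots,x_{i+q}),x_{i+q+1},\ldots,x_{p+q+1}),$$ and the Gerstenhaber bracket $[P,Q]^G=P\circ Q-(-1)^{pq}Q\circ P$. The alternator $\alpha:A(\mathfrak g,\mathfrak g)\to A(\mathfrak g,\mathfrak g)$ is the projection given, for $P\in A^p(\mathfrak g,\mathfrak g)$, by $$\alpha(P)(x_1,\ldots,x_{p+1})=\frac1{p!}\sum_{\sigma\in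 S_p}\mathrm{sgn}(\sigma)P(x_{\sigma(1)},\ldots,x_{\sigma(p)},x_{p+1}).$$ Its image in degree $p$ is identified with $C^p(\mathfrak g,\mathfrak g)=\mathrm{Hom}(\wedge^p\mathfrak g\otimes\mathfrak g,\mathfrak g)$ (maps skew-symmetric in the first $p$ arguments). A graded Lie algebra is a graded vector space with a degree-$0$ bilinear bracket satisfying graded skew-symmetry $[P,Q]=-(-1)^{pq}[Q,P]$ and the graded Jacobi identity $[P,[Q,R]]=[[P,Q],R]+(-1)^{pq}[Q,[P,R]]$. *)

theory Defs
  imports
    "HOL-Computational_Algebra.Polynomial"
    "HOL-Combinatorics.Permutations"
    "HOL-Library.Function_Algebras"
begin

locale pre_lie_algebra = vector_space scale
  for scale :: "'k::field \<Rightarrow> 'v::ab_group_add \<Rightarrow> 'v" (infixr \<open>*s\<close> 75) +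
  fixes prod :: "'v \<Rightarrow> 'v \<Rightarrow> 'v" (infixl \<open>\<cdot>\<close> 70)
  assumes linear_left: "Vector_Spaces.linear scale scale (\<lambda>x. x \<cdot> y)"
    and linear_right: "Vector_Spaces.linear scale scale (\<lambda>y. x \<cdot> y)"
    and left_symmetric: "(x \<cdot> y) \<cdot> z - x \<cdot> (y \<cdot> z) = (y \<cdot> x) \<cdot> z - y \<cdot> (x \<cdot> z)"

text \<open>A graded vector space is given as an internal direct sum of subspaces \<open>V p\<close> of an ambient
  vector space, which need not be exhausted by the \<open>V p\<close>; the graded space itself is \<open>total\<close>.\<close>

locale graded_vector_space = vector_space scale
  for scale :: "'k::field \<Rightarrow> 'c::ab_group_add \<Rightarrow> 'c" (infixr \<open>*s\<close> 75) +
  fixes V :: "nat \<Rightarrow> 'c set"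
  assumes subspace_component: "subspace (V p)"
    and components_independent:
      "\<lbrakk>finite I; \<And>p. p \<in> I \<Longrightarrow> x p \<in> V p; (\<Sum>p\<in>I. x p) = 0; p \<in> I\<rbrakk> \<Longrightarrow> x p = 0"
begin

definition total :: "'c set" where
  "total = span (\<Union>p. V p)"

end

locale graded_lie_algebra = graded_vector_space scale V
  for scale :: "'k::field \<Rightarrow> 'c::ab_group_add \<Rightarrow> 'c" (infixr \<open>*s\<close> 75) and V :: "nat \<Rightarrow> 'c set" +
  fixes br :: "'c \<Rightarrow> 'c \<Rightarrow> 'c"
  assumes br_add_left: "\<lbrakk>P \<in> total; Q \<in> total; R \<in> total\<rbrakk> \<Longrightarrow> br (P + Q) R = br P R + br Q R"
    and br_scale_left: "\<lbrakk>P \<in> total; R \<in> total\<rbrakk> \<Longrightarrow> br (c *s P) R = c *s br P R"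
    and br_add_right: "\<lbrakk>P \<in> total; Q \<in> total; R \<in> total\<rbrakk> \<Longrightarrow> br P (Q + R) = br P Q + br P R"
    and br_scale_right: "\<lbrakk>P \<in> total; R \<in> total\<rbrakk> \<Longrightarrow> br P (c *s R) = c *s br P R"
    and br_degree: "\<lbrakk>P \<in> V p; Q \<in> V q\<rbrakk> \<Longrightarrow> br P Q \<in> V (p + q)"
    and br_skew: "\<lbrakk>P \<in> V p; Q \<in> V q\<rbrakk> \<Longrightarrow> br P Q = - ((-1) ^ (p * q) *s br Q P)"
    and br_jacobi: "\<lbrakk>P \<in> V p; Q \<in> V q; R \<in> V r\<rbrakk> \<Longrightarrow>
      br P (br Q R) = br (br P Q) R + (-1) ^ (p * q) *s br Q (br P R)"

text \<open>A multilinear map in \<open>n\<close> arguments is a function on lists of length \<open>n\<close>, extended by \<open>0\<close> to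
  all other lists. Thus equality of maps is equality of functions, and the direct sum over all
  degrees is internal to the type \<open>'v list \<Rightarrow> 'v\<close> with its pointwise vector space structure.\<close>

definition fun_scale :: "('k \<Rightarrow> 'v \<Rightarrow> 'v) \<Rightarrow> 'k \<Rightarrow> ('v list \<Rightarrow> 'v) \<Rightarrow> 'v list \<Rightarrow> 'v" where
  "fun_scale s c P = (\<lambda>xs. s c (P xs))"

text \<open>\<open>tensor_hom s p\<close> is \<open>A\<^sup>p\<close>, the space of linear maps from the \<open>(p + 1)\<close>-fold tensor power.\<close>

definition tensor_hom :: "('k::field \<Rightarrow> 'v::ab_group_add \<Rightarrow> 'v) \<Rightarrow> nat \<Rightarrow> ('v list \<Rightarrow> 'v) set" where
  "tensor_hom s p = {P.
     (\<forall>xs i. length xs = p + 1 \<longrightarrow> i < p + 1 \<longrightarrow>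
        Vector_Spaces.linear s s (\<lambda>v. P (xs[i := v]))) \<and>
     (\<forall>xs. length xs \<noteq> p + 1 \<longrightarrow> P xs = 0)}"

definition cochains :: "('k::field \<Rightarrow> 'v::ab_group_add \<Rightarrow> 'v) \<Rightarrow> nat \<Rightarrow> ('v list \<Rightarrow> 'v) set" where
  "cochains s p = {P \<in> tensor_hom s p.
     \<forall>\<sigma> xs. \<sigma> permutes {..<p} \<longrightarrow> length xs = p + 1 \<longrightarrow>
        P (permute_list \<sigma> xs) = s (of_int (sign \<sigma>)) (P xs)}"

text \<open>Positions in lists are counted from \<open>0\<close>, hence the sign \<open>(-1) ^ (i * q)\<close>.\<close>

definition gerst_circ ::
  "('k::field \<Rightarrow> 'v::ab_group_add \<Rightarrow> 'v) \<Rightarrow> nat \<Rightarrow> nat \<Rightarrow> ('v list \<Rightarrow> 'v) \<Rightarrow> ('v list \<Rightarrow> 'v) \<Rightarrow> 'v list \<Rightarrow> 'v"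
where
  "gerst_circ s p q P Q = (\<lambda>xs. if length xs = p + q + 1
     then \<Sum>i\<le>p. s ((-1) ^ (i * q))
            (P (take i xs @ [Q (take (q + 1) (drop i xs))] @ drop (i + q + 1) xs))
     else 0)"

definition gerst_bracket ::
  "('k::field \<Rightarrow> 'v::ab_group_add \<Rightarrow> 'v) \<Rightarrow> nat \<Rightarrow> nat \<Rightarrow> ('v list \<Rightarrow> 'v) \<Rightarrow> ('v list \<Rightarrow> 'v) \<Rightarrow> 'v list \<Rightarrow> 'v"
where
  "gerst_bracket s p q P Q =
     gerst_circ s p q P Q - fun_scale s ((-1) ^ (p * q)) (gerst_circ s q p Q P)"

definition alternator ::
  "('k::field_char_0 \<Rightarrow> 'v::ab_group_add \<Rightarrow> 'v) \<Rightarrow> nat \<Rightarrow> ('v list \<Rightarrow> 'v) \<Rightarrow> 'v list \<Rightarrow> 'v"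
where
  "alternator s p P = (\<lambda>xs. if length xs = p + 1
     then s (1 / fact p)
            (\<Sum>\<sigma> | \<sigma> permutes {..<p}. s (of_int (sign \<sigma>)) (P (permute_list \<sigma> xs)))
     else 0)"

definition homog_bracket ::
  "('k::field_char_0 \<Rightarrow> 'v::ab_group_add \<Rightarrow> 'v) \<Rightarrow> nat \<Rightarrow> nat \<Rightarrow> ('v list \<Rightarrow> 'v) \<Rightarrow> ('v list \<Rightarrow> 'v) \<Rightarrow> 'v list \<Rightarrow> 'v"
where
  "homog_bracket s p q P Q =
     fun_scale s (fact (p + q) / (fact p * fact q)) (alternator s (p + q) (gerst_bracket s p q P Q))"

text \<open>The bracket on the direct sum is the biadditive extension of the homogeneous one. On elements
  of the direct sum the index sets below are finite.\<close>

definition component :: "nat \<Rightarrow> ('v list \<Rightarrow> 'v::zero) \<Rightarrow> 'v list \<Rightarrow> 'v" where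
  "component p P = (\<lambda>xs. if length xs = p + 1 then P xs else 0)"

definition bracketC ::
  "('k::field_char_0 \<Rightarrow> 'v::ab_group_add \<Rightarrow> 'v) \<Rightarrow> ('v list \<Rightarrow> 'v) \<Rightarrow> ('v list \<Rightarrow> 'v) \<Rightarrow> 'v list \<Rightarrow> 'v"
where
  "bracketC s P Q = (\<Sum>p | component p P \<noteq> 0. \<Sum>q | component q Q \<noteq> 0.
     homog_bracket s p q (component p P) (component q Q))"

lemma component_homogeneous:
  assumes "P \<in> tensor_hom s p"
  shows "component r P = (if r = p then P else 0)"
  using assms by (auto simp: component_def tensor_hom_def fun_eq_iff)

lemma gerst_circ_zero:
  assumes "vector_space s" "P \<in> tensor_hom s p"
  shows "gerst_circ s p q P 0 = 0" "gerst_circ s q p 0 P = 0"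
proof -
  interpret vector_space s by fact
  have "P (take i xs @ [0] @ drop (i + q + 1) xs) = 0"
    if "length xs = p + q + 1" "i \<le> p" for xs i
  proof -
    let ?ys = "take i xs @ [0] @ drop (i + q + 1) xs"
    have "length ?ys = p + 1" using that by simp
    moreover have "i < p + 1" using that by simp
    ultimately have "Vector_Spaces.linear s s (\<lambda>v. P (?ys[i := v]))"
      using assms(2) unfolding tensor_hom_def by blast
    then have "P (?ys[i := 0]) = 0"
      unfolding module_hom_iff_linear[symmetric] by (rule module_hom.zero)
    moreover have "?ys[i := 0] = ?ys" using that by (simp add: list_update_append)
    ultimately show ?thesis by simp
  qed
  then show "gerst_circ s p q P 0 = 0"
    by (auto simp: gerst_circ_def fun_eq_iff)
  show "gerst_circ s q p 0 P = 0"
    by (auto simp: gerst_circ_def fun_eq_iff)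
qed

lemma bracketC_homogeneous:
  assumes "vector_space s" "P \<in> cochains s p" "Q \<in> cochains s q"
  shows "bracketC s P Q = homog_bracket s p q P Q"
proof -
  interpret vector_space s by fact
  have P: "P \<in> tensor_hom s p" and Q: "Q \<in> tensor_hom s q"
    using assms by (auto simp: cochains_def)
  show ?thesis
  proof (cases "P = 0 \<or> Q = 0")
    case True
    then have "gerst_bracket s p q P Q = 0"
      using gerst_circ_zero[OF assms(1) P] gerst_circ_zero[OF assms(1) Q]
      by (elim disjE) (simp_all add: gerst_bracket_def fun_scale_def zero_fun_def fun_diff_def)
    then have "homog_bracket s p q P Q = 0"
      by (auto simp: homog_bracket_def alternator_def fun_scale_def fun_eq_iff)
    moreover have "bracketC s P Q = 0"
      using True component_homogeneous[OF P] component_homogeneous[OF Q]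
      by (auto simp: bracketC_def zero_fun_def[symmetric])
    ultimately show ?thesis by simp
  next
    case False
    then have "{r. component r P \<noteq> 0} = {p}" "{r. component r Q \<noteq> 0} = {q}"
      using component_homogeneous[OF P] component_homogeneous[OF Q] by auto
    then show ?thesis
      using component_homogeneous[OF P] component_homogeneous[OF Q] by (simp add: bracketC_def)
  qed
qed

end

theory Submission
  imports Defs
begin

text \<open>The Gerstenhaber bracket already satisfies the graded Jacobi identity on all multilinear maps, and
  the alternator carries it over to the maps that are skew in all arguments but the last.

  The Jacobi identity holds because the associator \<open>(P \<circ> Q) \<circ> R - P \<circ> (Q \<circ> R)\<close> consists of the terms
  in which \<open>Q\<close> and \<open>R\<close> are inserted into different arguments of \<open>P\<close>. Exchanging \<open>Q\<close> and \<open>R\<close> permutes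
  these terms and multiplies them by \<open>(-1) ^ (q * r)\<close>, so \<open>\<circ>\<close> is graded right-symmetric
  (\<open>gerst_circ_right_symmetric\<close>), and the graded commutator of such a product is a graded Lie bracket
  (\<open>gerst_bracket_jacobi\<close>).

  The passage to cochains rests on the equations \<open>\<alpha> (P \<circ> \<alpha> Q) = \<alpha> (P \<circ> Q) = \<alpha> (\<alpha> P \<circ> Q)\<close>. As a function
  of \<open>Q\<close> or of \<open>P\<close> alone, \<open>\<alpha> (P \<circ> Q)\<close> changes sign when two neighbouring arguments of that map, both
  different from its last one, are exchanged; a linear functional with this property takes the same value
  at a map and at its alternation (\<open>functional_absorbs_alternator\<close>). For \<open>Q\<close> this is an exchange of two
  variables. For \<open>P\<close> one of the two arguments may be the inserted value of \<open>Q\<close>; then the exchange moves a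
  variable past the \<open>q + 1\<close> arguments of \<open>Q\<close>, and the sign \<open>(-1) ^ (q + 1)\<close> of this rotation is compensated,
  up to one factor \<open>-1\<close>, by the signs \<open>(-1) ^ (i * q)\<close> in the definition of \<open>\<circ>\<close>.

  Hence both nested brackets \<open>[P, [Q, R]]\<close> and \<open>[[P, Q], R]\<close> of cochains are alternations of the
  nested Gerstenhaber brackets with the same factor \<open>(p + q + r)! / (p! q! r!)\<close>, and the Jacobi identity
  follows. In degree one the bracket \<open>[\<pi>, \<pi>]\<close> is twice the associator of \<open>\<pi>\<close> antisymmetrised in its first two
  arguments, so it vanishes exactly for pre-Lie products.\<close>

section \<open>Multilinear maps on lists\<close>

locale char0_vector_space = vector_space scale
  for scale :: "'k::field_char_0 \<Rightarrow> 'v::ab_group_add \<Rightarrow> 'v" (infixr \<open>*s\<close> 75)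
begin

lemma tensor_hom_add:
  assumes "P \<in> tensor_hom scale p" "length xs = p + 1" "i < p + 1"
  shows "P (xs[i := u + v]) = P (xs[i := u]) + P (xs[i := v])"
proof -
  have "Vector_Spaces.linear scale scale (\<lambda>v. P (xs[i := v]))"
    using assms unfolding tensor_hom_def by blast
  then show ?thesis
    unfolding module_hom_iff_linear[symmetric] by (rule module_hom.add)
qed

lemma tensor_hom_scale:
  assumes "P \<in> tensor_hom scale p" "length xs = p + 1" "i < p + 1"
  shows "P (xs[i := c *s v]) = c *s P (xs[i := v])"
proof -
  have "Vector_Spaces.linear scale scale (\<lambda>v. P (xs[i := v]))"
    using assms unfolding tensor_hom_def by blast
  then show ?thesis
    unfolding module_hom_iff_linear[symmetric] by (rule module_hom.scale)
qed

lemma tensor_hom_sum: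
  assumes "P \<in> tensor_hom scale p" "length xs = p + 1" "i < p + 1"
  shows "P (xs[i := (\<Sum>j\<in>J. f j)]) = (\<Sum>j\<in>J. P (xs[i := f j]))"
proof -
  have "Vector_Spaces.linear scale scale (\<lambda>v. P (xs[i := v]))"
    using assms unfolding tensor_hom_def by blast
  then show ?thesis
    unfolding module_hom_iff_linear[symmetric] by (rule module_hom.sum)
qed

lemma tensor_hom_outside: "P \<in> tensor_hom scale p \<Longrightarrow> length xs \<noteq> p + 1 \<Longrightarrow> P xs = 0"
  by (simp add: tensor_hom_def)

lemma tensor_homI:
  assumes "\<And>xs i u v. length xs = p + 1 \<Longrightarrow> i < p + 1 \<Longrightarrow>
      P (xs[i := u + v]) = P (xs[i := u]) + P (xs[i := v])"
    and "\<And>xs i c v. length xs = p + 1 \<Longrightarrow> i < p + 1 \<Longrightarrow>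
      P (xs[i := c *s v]) = c *s P (xs[i := v])"
    and "\<And>xs. length xs \<noteq> p + 1 \<Longrightarrow> P xs = 0"
  shows "P \<in> tensor_hom scale p"
  using assms unfolding tensor_hom_def module_hom_iff_linear[symmetric]
  by (auto intro!: module_hom.intro module_hom_axioms.intro module_axioms)

lemma tensor_hom_plus:
  "P \<in> tensor_hom scale p \<Longrightarrow> Q \<in> tensor_hom scale p \<Longrightarrow> P + Q \<in> tensor_hom scale p"
  by (rule tensor_homI)
    (simp_all add: tensor_hom_add tensor_hom_scale tensor_hom_outside scale_right_distrib)

lemma fun_scale_apply: "fun_scale scale c F xs = c *s F xs"
  by (simp add: fun_scale_def)

lemma tensor_hom_fun_scale:
  "P \<in> tensor_hom scale p \<Longrightarrow> fun_scale scale c P \<in> tensor_hom scale p"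
  by (rule tensor_homI)
    (simp_all add: fun_scale_def tensor_hom_add tensor_hom_scale tensor_hom_outside
      scale_right_distrib mult.commute)

lemma tensor_hom_zero: "0 \<in> tensor_hom scale p"
  by (rule tensor_homI) simp_all

lemma tensor_hom_minus:
  assumes "P \<in> tensor_hom scale p" "Q \<in> tensor_hom scale p"
  shows "P - Q \<in> tensor_hom scale p"
proof -
  have "P - Q = P + fun_scale scale (- 1) Q" by (simp add: fun_scale_def fun_eq_iff)
  then show ?thesis using tensor_hom_plus tensor_hom_fun_scale assms by metis
qed

section \<open>Partial compositions\<close>

text \<open>\<open>P (insert_value q Q i xs)\<close> is the partial composition of \<open>P\<close> and \<open>Q\<close> at position \<open>i\<close>, the building
  block of \<open>gerst_circ\<close>. Separating the list from the outer map \<open>P\<close> turns identities of partial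
  compositions into identities of lists, which can be compared entry by entry.\<close>
definition insert_value :: "nat \<Rightarrow> ('v list \<Rightarrow> 'v) \<Rightarrow> nat \<Rightarrow> 'v list \<Rightarrow> 'v list" where
  "insert_value q Q i xs = take i xs @ [Q (take (q + 1) (drop i xs))] @ drop (i + q + 1) xs"

lemma length_insert_value:
  "i + q < length xs \<Longrightarrow> length (insert_value q Q i xs) = length xs - q"
  by (simp add: insert_value_def)

lemma nth_insert_value:
  assumes "i + q < length xs" "j < length xs - q"
  shows "insert_value q Q i xs ! j =
    (if j < i then xs ! j else if j = i then Q (take (q + 1) (drop i xs)) else xs ! (j + q))"
  using assms by (auto simp: insert_value_def nth_append nth_Cons' intro!: arg_cong[of _ _ "(!) xs"])

lemma insert_value_update_left:
  assumes "i + q < length xs" "m < i"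
  shows "insert_value q Q i (xs[m := v]) = (insert_value q Q i xs)[m := v]"
  using assms
  by (auto simp: nth_insert_value length_insert_value nth_list_update drop_update_cancel
      intro!: nth_equalityI)

lemma insert_value_update_right:
  assumes "i + q < m" "m < length xs"
  shows "insert_value q Q i (xs[m := v]) = (insert_value q Q i xs)[m - q := v]"
  using assms
  by (auto simp: nth_insert_value length_insert_value nth_list_update drop_update_swap
      intro!: nth_equalityI)

text \<open>Exhibits the inserted value as an updated entry, the form in which multilinearity of the outer map
  applies to it.\<close>

lemma insert_value_eq_update:
  assumes "i + q < length xs"
  shows "insert_value q Q i xs = (insert_value q (\<lambda>_. 0) i xs)[i := Q (take (q + 1) (drop i xs))]"
  using assms
  by (auto simp: nth_insert_value length_insert_value nth_list_update intro!: nth_equalityI)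

lemma insert_value_update_block:
  assumes "i + q < length xs" "i \<le> m" "m \<le> i + q"
  shows "insert_value q Q i (xs[m := v]) =
    (insert_value q (\<lambda>_. 0) i xs)[i := Q ((take (q + 1) (drop i xs))[m - i := v])]"
  using assms
  by (auto simp: nth_insert_value length_insert_value nth_list_update drop_update_swap
      take_update_swap intro!: nth_equalityI)

text \<open>Each variable enters a partial composition in exactly one way: as an argument of the outer map
  to the left or to the right of the inserted value, or as an argument of the inner map.\<close>

lemma partial_composition_add:
  assumes P: "P \<in> tensor_hom scale p" and Q: "Q \<in> tensor_hom scale q"
    and n: "length xs = p + q + 1" "m < p + q + 1" "i \<le> p"
  shows "P (insert_value q Q i (xs[m := u + v])) =
    P (insert_value q Q i (xs[m := u])) + P (insert_value q Q i (xs[m := v]))"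
proof -
  consider "m < i" | "i + q < m" | "i \<le> m" "m \<le> i + q" by linarith
  then show ?thesis
    using n by cases (simp_all add: insert_value_update_left insert_value_update_right
      insert_value_update_block length_insert_value tensor_hom_add[OF P] tensor_hom_add[OF Q])
qed

lemma partial_composition_scale:
  assumes P: "P \<in> tensor_hom scale p" and Q: "Q \<in> tensor_hom scale q"
    and n: "length xs = p + q + 1" "m < p + q + 1" "i \<le> p"
  shows "P (insert_value q Q i (xs[m := c *s v])) = c *s P (insert_value q Q i (xs[m := v]))"
proof -
  consider "m < i" | "i + q < m" | "i \<le> m" "m \<le> i + q" by linarith
  then show ?thesis
    using n by cases (simp_all add: insert_value_update_left insert_value_update_right
      insert_value_update_block length_insert_value tensor_hom_scale[OF P] tensor_hom_scale[OF Q])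
qed

lemma gerst_circ_insert_value:
  "gerst_circ scale p q P Q = (\<lambda>xs. if length xs = p + q + 1
     then \<Sum>i\<le>p. ((-1) ^ (i * q)) *s P (insert_value q Q i xs) else 0)"
  by (simp add: gerst_circ_def insert_value_def fun_eq_iff)

lemma gerst_circ_tensor_hom:
  assumes P: "P \<in> tensor_hom scale p" and Q: "Q \<in> tensor_hom scale q"
  shows "gerst_circ scale p q P Q \<in> tensor_hom scale (p + q)"
  by (rule tensor_homI)
    (simp_all add: gerst_circ_insert_value partial_composition_add[OF assms]
      partial_composition_scale[OF assms] scale_right_distrib sum.distrib scale_sum_right
      mult.commute)

lemma gerst_circ_add_left:
  "gerst_circ scale p q (P + P') Q = gerst_circ scale p q P Q + gerst_circ scale p q P' Q"
  by (simp add: gerst_circ_insert_value fun_eq_iff scale_right_distrib sum.distrib)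

lemma gerst_circ_scale_left:
  "gerst_circ scale p q (fun_scale scale c P) Q = fun_scale scale c (gerst_circ scale p q P Q)"
  by (simp add: gerst_circ_insert_value fun_eq_iff fun_scale_def scale_sum_right mult.commute)

text \<open>Unlike additivity in the outer map, this depends on the multilinearity of \<open>P\<close>.\<close>

lemma gerst_circ_add_right:
  assumes "P \<in> tensor_hom scale p"
  shows "gerst_circ scale p q P (Q + Q') = gerst_circ scale p q P Q + gerst_circ scale p q P Q'"
proof -
  have "P (insert_value q (Q + Q') i xs) = P (insert_value q Q i xs) + P (insert_value q Q' i xs)"
    if "length xs = p + q + 1" "i \<le> p" for i xs
    using that by (subst (1 2 3) insert_value_eq_update)
      (simp_all add: tensor_hom_add[OF assms] length_insert_value)
  then show ?thesis
    by (simp add: gerst_circ_insert_value fun_eq_iff scale_right_distrib sum.distrib)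
qed

lemma gerst_circ_scale_right:
  assumes "P \<in> tensor_hom scale p"
  shows "gerst_circ scale p q P (fun_scale scale c Q) = fun_scale scale c (gerst_circ scale p q P Q)"
proof -
  have "P (insert_value q (fun_scale scale c Q) i xs) = c *s P (insert_value q Q i xs)"
    if "length xs = p + q + 1" "i \<le> p" for i xs
    using that by (subst (1 2) insert_value_eq_update)
      (simp_all add: tensor_hom_scale[OF assms] length_insert_value fun_scale_def)
  then show ?thesis
    by (simp add: gerst_circ_insert_value fun_eq_iff fun_scale_def scale_sum_right mult.commute)
qed

section \<open>The graded Jacobi identity for the Gerstenhaber bracket\<close>

text \<open>Insertions into two different slots do not interact; the shift by \<open>r\<close> accounts for the arguments that
  the left insertion consumes.\<close>

lemma insert_value_commute:
  assumes "k < i" "i + q + r < length xs"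
  shows "insert_value q Q i (insert_value r R k xs) = insert_value r R k (insert_value q Q (i + r) xs)"
proof -
  have "take (q + 1) (drop i (insert_value r R k xs)) = take (q + 1) (drop (i + r) xs)"
    using assms by (auto simp: nth_insert_value length_insert_value ac_simps intro!: nth_equalityI)
  moreover have "take (r + 1) (drop k (insert_value q Q (i + r) xs)) = take (r + 1) (drop k xs)"
    using assms by (auto simp: nth_insert_value length_insert_value intro!: nth_equalityI)
  ultimately show ?thesis
    using assms by (auto simp: nth_insert_value length_insert_value ac_simps intro!: nth_equalityI)
qed

lemma insert_value_nested:
  assumes "j \<le> q" "i + q + r < length xs"
  shows "insert_value q Q i (insert_value r R (i + j) xs) = (insert_value (q + r) (\<lambda>_. 0) i xs)
    [i := Q (insert_value r R j (take (q + r + 1) (drop i xs)))]"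
proof -
  have "take (r + 1) (drop (i + j) xs) = take (r + 1) (drop j (take (q + r + 1) (drop i xs)))"
    using assms by (auto simp: ac_simps intro!: nth_equalityI)
  then have "take (q + 1) (drop i (insert_value r R (i + j) xs)) =
      insert_value r R j (take (q + r + 1) (drop i xs))"
    using assms by (auto simp: nth_insert_value length_insert_value ac_simps intro!: nth_equalityI)
  then show ?thesis
    using assms by (auto simp: nth_insert_value length_insert_value nth_list_update ac_simps
      intro!: nth_equalityI)
qed

text \<open>After \<open>Q\<close> has been inserted at position \<open>i\<close> of \<open>P\<close>, a position \<open>k\<close> of \<open>P \<circ> Q\<close> lies to the left of the
  block of arguments of \<open>Q\<close>, inside it, or to its right. In the last case it is the position \<open>b = k - q\<close> of \<open>P\<close>.\<close>

lemma sum_split_at_block: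
  fixes f :: "nat \<Rightarrow> 'a::comm_monoid_add"
  assumes "i \<le> p"
  shows "(\<Sum>k\<le>p + q. f k) = (\<Sum>k<i. f k) + (\<Sum>j\<le>q. f (i + j)) + (\<Sum>b\<in>{i<..p}. f (b + q))"
proof -
  have "{..p + q} = {..<i} \<union> {i..i + q} \<union> {i + q<..p + q}" using assms by auto
  moreover have "sum f ({..<i} \<union> {i..i + q} \<union> {i + q<..p + q}) =
      sum f {..<i} + sum f {i..i + q} + sum f {i + q<..p + q}"
    by (simp add: sum.union_disjoint disjoint_iff)
  moreover have "sum f {i..i + q} = (\<Sum>j\<le>q. f (i + j))"
    by (rule sum.reindex_bij_witness[of _ "\<lambda>j. i + j" "\<lambda>k. k - i"]) auto
  moreover have "sum f {i + q<..p + q} = (\<Sum>b\<in>{i<..p}. f (b + q))"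
    by (rule sum.reindex_bij_witness[of _ "\<lambda>b. b + q" "\<lambda>k. k - q"]) auto
  ultimately show ?thesis by simp
qed

text \<open>The part of \<open>(P \<circ> Q) \<circ> R\<close> in which \<open>R\<close> enters an argument of \<open>P\<close> to the left of the one that \<open>Q\<close> enters.\<close>
definition disjoint_insertions ::
  "nat \<Rightarrow> ('v list \<Rightarrow> 'v) \<Rightarrow> nat \<Rightarrow> ('v list \<Rightarrow> 'v) \<Rightarrow> nat \<Rightarrow> ('v list \<Rightarrow> 'v) \<Rightarrow> 'v list \<Rightarrow> 'v" where
  "disjoint_insertions p P q Q r R xs = (\<Sum>i\<le>p. \<Sum>k<i.
     ((-1) ^ (k * r + i * q)) *s P (insert_value q Q i (insert_value r R k xs)))"

text \<open>Of the three positions of \<open>R\<close> relative to \<open>Q\<close>, the inner one yields \<open>P \<circ> (Q \<circ> R)\<close>. The right one is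
  the left one with the roles of \<open>Q\<close> and \<open>R\<close> exchanged; there \<open>R\<close> sits at position \<open>b + q\<close>
  of \<open>P \<circ> Q\<close> instead of \<open>b\<close>, which costs the sign \<open>(-1) ^ (q * r)\<close>.\<close>

lemma gerst_circ_assoc:
  assumes P: "P \<in> tensor_hom scale p" and n: "length xs = p + q + r + 1"
  shows "gerst_circ scale (p + q) r (gerst_circ scale p q P Q) R xs =
    gerst_circ scale p (q + r) P (gerst_circ scale q r Q R) xs
    + disjoint_insertions p P q Q r R xs + ((-1) ^ (q * r)) *s disjoint_insertions p P r R q Q xs"
proof -
  define T where "T i k = ((-1) ^ (k * r + i * q)) *s P (insert_value q Q i (insert_value r R k xs))"
    for i k
  have "gerst_circ scale (p + q) r (gerst_circ scale p q P Q) R xs = (\<Sum>k\<le>p + q. \<Sum>i\<le>p. T i k)"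
    using n by (simp add: gerst_circ_insert_value length_insert_value T_def scale_sum_right power_add)
  also have "\<dots> = (\<Sum>i\<le>p. \<Sum>k\<le>p + q. T i k)" by (rule sum.swap)
  also have "\<dots> = (\<Sum>i\<le>p. \<Sum>k<i. T i k) + (\<Sum>i\<le>p. \<Sum>j\<le>q. T i (i + j))
      + (\<Sum>i\<le>p. \<Sum>b\<in>{i<..p}. T i (b + q))"
    unfolding sum.distrib[symmetric] by (intro sum.cong refl sum_split_at_block) simp
  also have "(\<Sum>i\<le>p. \<Sum>j\<le>q. T i (i + j)) =
      gerst_circ scale p (q + r) P (gerst_circ scale q r Q R) xs"
  proof -
    have "(\<Sum>j\<le>q. T i (i + j)) =
        ((-1) ^ (i * (q + r))) *s P (insert_value (q + r) (gerst_circ scale q r Q R) i xs)"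
      if "i \<le> p" for i
    proof -
      let ?ys = "insert_value (q + r) (\<lambda>_. 0) i xs" and ?zs = "take (q + r + 1) (drop i xs)"
      have ys: "length ?ys = p + 1" "i < p + 1" using n that by (auto simp: length_insert_value)
      have "insert_value (q + r) (gerst_circ scale q r Q R) i xs =
          ?ys[i := \<Sum>j\<le>q. ((-1) ^ (j * r)) *s Q (insert_value r R j ?zs)]"
        using n that by (subst insert_value_eq_update) (simp_all add: gerst_circ_insert_value)
      then have "P (insert_value (q + r) (gerst_circ scale q r Q R) i xs) =
          (\<Sum>j\<le>q. ((-1) ^ (j * r)) *s P (insert_value q Q i (insert_value r R (i + j) xs)))"
        using n that
        by (simp add: tensor_hom_sum[OF P ys] tensor_hom_scale[OF P ys] insert_value_nested)
      then show ?thesis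
        by (simp add: T_def scale_sum_right power_add[symmetric] algebra_simps)
    qed
    then show ?thesis using n by (simp add: gerst_circ_insert_value)
  qed
  also have "(\<Sum>i\<le>p. \<Sum>b\<in>{i<..p}. T i (b + q)) =
      ((-1) ^ (q * r)) *s disjoint_insertions p P r R q Q xs"
  proof -
    have "(\<Sum>i\<le>p. \<Sum>b\<in>{i<..p}. T i (b + q)) = (\<Sum>b\<le>p. \<Sum>i<b. T i (b + q))"
      unfolding sum.Sigma[OF finite_atMost ballI[OF finite_greaterThanAtMost]]
        sum.Sigma[OF finite_atMost ballI[OF finite_lessThan]]
      by (rule sum.reindex_bij_witness[of _ "\<lambda>(b, i). (i, b)" "\<lambda>(i, b). (b, i)"]) auto
    also have "\<dots> = (\<Sum>b\<le>p. \<Sum>i<b. ((-1) ^ (q * r)) *s (((-1) ^ (i * q + b * r)) *s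
        P (insert_value r R b (insert_value q Q i xs))))"
      using n by (intro sum.cong refl)
        (simp add: T_def insert_value_commute power_add[symmetric] algebra_simps)
    finally show ?thesis by (simp add: disjoint_insertions_def scale_sum_right)
  qed
  finally show ?thesis by (simp add: T_def disjoint_insertions_def algebra_simps)
qed

lemma gerst_circ_outside: "length xs \<noteq> p + q + 1 \<Longrightarrow> gerst_circ scale p q P Q xs = 0"
  by (simp add: gerst_circ_def)

text \<open>By \<open>gerst_circ_assoc\<close> the associator is a sum of two terms that the exchange of \<open>Q\<close> and \<open>R\<close> swaps up
  to the factor \<open>(-1) ^ (q * r)\<close>.\<close>

lemma gerst_circ_right_symmetric:
  assumes P: "P \<in> tensor_hom scale p"
  shows "gerst_circ scale (p + q) r (gerst_circ scale p q P Q) R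
      - gerst_circ scale p (q + r) P (gerst_circ scale q r Q R) =
    fun_scale scale ((-1) ^ (q * r)) (gerst_circ scale (p + r) q (gerst_circ scale p r P R) Q
      - gerst_circ scale p (r + q) P (gerst_circ scale r q R Q))" (is "?L = ?R")
proof
  fix xs
  show "?L xs = ?R xs"
  proof (cases "length xs = p + q + r + 1")
    case True
    then have "length xs = p + r + q + 1" by simp
    note gerst_circ_assoc[OF P this]
    with gerst_circ_assoc[OF P True] show ?thesis
      by (simp add: fun_scale_def scale_right_distrib power_add[symmetric] ac_simps)
  qed (simp add: gerst_circ_outside fun_scale_def)
qed

lemma gerst_circ_diff_left:
  "gerst_circ scale p q (P - P') Q = gerst_circ scale p q P Q - gerst_circ scale p q P' Q"
  using gerst_circ_add_left[of p q "P - P'" P' Q] by simp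

lemma gerst_circ_diff_right:
  assumes "P \<in> tensor_hom scale p"
  shows "gerst_circ scale p q P (Q - Q') = gerst_circ scale p q P Q - gerst_circ scale p q P Q'"
  using gerst_circ_add_right[OF assms, of q "Q - Q'" Q'] by simp

lemma fun_scale_sign: "fun_scale scale ((-1) ^ n) F = (if even n then F else - F)"
  by (simp add: fun_scale_def fun_eq_iff)

text \<open>The twelve composites of \<open>P\<close>, \<open>Q\<close> and \<open>R\<close> in the identity form six associators, and right symmetry
  for each choice of the outermost map pairs these off. The signs depend on the
  parities of the degrees only.\<close>

theorem gerst_bracket_jacobi:
  assumes P: "P \<in> tensor_hom scale p" and Q: "Q \<in> tensor_hom scale q"
    and R: "R \<in> tensor_hom scale r"
  shows "gerst_bracket scale p (q + r) P (gerst_bracket scale q r Q R) =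
    gerst_bracket scale (p + q) r (gerst_bracket scale p q P Q) R
    + fun_scale scale ((-1) ^ (p * q))
        (gerst_bracket scale q (p + r) Q (gerst_bracket scale p r P R))"
proof -
  define S where "S n = fun_scale scale ((-1 :: 'k) ^ n)" for n
  define o\<^sub>p\<^sub>q where "o\<^sub>p\<^sub>q = gerst_circ scale p q P Q"
  define o\<^sub>q\<^sub>p where "o\<^sub>q\<^sub>p = gerst_circ scale q p Q P"
  define o\<^sub>p\<^sub>r where "o\<^sub>p\<^sub>r = gerst_circ scale p r P R"
  define o\<^sub>r\<^sub>p where "o\<^sub>r\<^sub>p = gerst_circ scale r p R P"
  define o\<^sub>q\<^sub>r where "o\<^sub>q\<^sub>r = gerst_circ scale q r Q R"
  define o\<^sub>r\<^sub>q where "o\<^sub>r\<^sub>q = gerst_circ scale r q R Q"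
  let ?outP = "gerst_circ scale p (q + r) P" and ?inP = "\<lambda>F. gerst_circ scale (q + r) p F P"
  let ?outQ = "gerst_circ scale q (p + r) Q" and ?inQ = "\<lambda>F. gerst_circ scale (p + r) q F Q"
  let ?outR = "gerst_circ scale r (p + q) R" and ?inR = "\<lambda>F. gerst_circ scale (p + q) r F R"
  note defs = o\<^sub>p\<^sub>q_def o\<^sub>q\<^sub>p_def o\<^sub>p\<^sub>r_def o\<^sub>r\<^sub>p_def o\<^sub>q\<^sub>r_def o\<^sub>r\<^sub>q_def
  \<comment> \<open>Right symmetry, solved for one composite in each case, so that it rewrites that composite away.\<close>
  have P_first: "?inR o\<^sub>p\<^sub>q = ?outP o\<^sub>q\<^sub>r + S (q * r) (?inQ o\<^sub>p\<^sub>r - ?outP o\<^sub>r\<^sub>q)"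
    using gerst_circ_right_symmetric[OF P, of q r Q R] by (simp add: defs S_def add.commute diff_eq_eq)
  have Q_first: "?inR o\<^sub>q\<^sub>p = ?outQ o\<^sub>p\<^sub>r + S (p * r) (?inP o\<^sub>q\<^sub>r - ?outQ o\<^sub>r\<^sub>p)"
    using gerst_circ_right_symmetric[OF Q, of p r P R] by (simp add: defs S_def add.commute diff_eq_eq)
  have R_first: "?inQ o\<^sub>r\<^sub>p = ?outR o\<^sub>p\<^sub>q + S (p * q) (?inP o\<^sub>r\<^sub>q - ?outR o\<^sub>q\<^sub>p)"
    using gerst_circ_right_symmetric[OF R, of p q P Q] by (simp add: defs S_def add.commute diff_eq_eq)
  have left: "gerst_bracket scale p (q + r) P (gerst_bracket scale q r Q R) =
      ?outP o\<^sub>q\<^sub>r - S (q * r) (?outP o\<^sub>r\<^sub>q) - S (p * (q + r)) (?inP o\<^sub>q\<^sub>r - S (q * r) (?inP o\<^sub>r\<^sub>q))"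
    by (simp add: gerst_bracket_def defs S_def gerst_circ_diff_left gerst_circ_scale_left
      gerst_circ_diff_right[OF P] gerst_circ_scale_right[OF P])
  have right1: "gerst_bracket scale (p + q) r (gerst_bracket scale p q P Q) R =
      ?inR o\<^sub>p\<^sub>q - S (p * q) (?inR o\<^sub>q\<^sub>p) - S ((p + q) * r) (?outR o\<^sub>p\<^sub>q - S (p * q) (?outR o\<^sub>q\<^sub>p))"
    by (simp add: gerst_bracket_def defs S_def gerst_circ_diff_left gerst_circ_scale_left
      gerst_circ_diff_right[OF R] gerst_circ_scale_right[OF R])
  have right2: "gerst_bracket scale q (p + r) Q (gerst_bracket scale p r P R) =
      ?outQ o\<^sub>p\<^sub>r - S (p * r) (?outQ o\<^sub>r\<^sub>p) - S (q * (p + r)) (?inQ o\<^sub>p\<^sub>r - S (p * r) (?inQ o\<^sub>r\<^sub>p))"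
    by (simp add: gerst_bracket_def defs S_def gerst_circ_diff_left gerst_circ_scale_left
      gerst_circ_diff_right[OF Q] gerst_circ_scale_right[OF Q])
  have S_sign: "S n F = (if even n then F else - F)" for n F
    unfolding S_def by (rule fun_scale_sign)
  show ?thesis
    unfolding left right1 right2 S_def[symmetric] P_first Q_first R_first
    by (cases "even p"; cases "even q"; cases "even r"; simp add: S_sign algebra_simps)
qed

section \<open>The alternator absorbs the alternator of either factor\<close>

lemma alternator_add:
  "alternator scale n (F + G) = alternator scale n F + alternator scale n G"
  by (simp add: alternator_def fun_eq_iff scale_right_distrib sum.distrib)

lemma alternator_scale:
  "alternator scale n (fun_scale scale c F) = fun_scale scale c (alternator scale n F)"
  by (simp add: alternator_def fun_eq_iff fun_scale_def scale_sum_right mult_ac)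

lemma alternator_cong:
  "(\<And>xs. length xs = n + 1 \<Longrightarrow> F xs = G xs) \<Longrightarrow> alternator scale n F = alternator scale n G"
  by (auto simp: alternator_def fun_eq_iff intro!: arg_cong2[of _ _ _ _ scale] sum.cong)

lemma alternator_outside: "length xs \<noteq> n + 1 \<Longrightarrow> alternator scale n F xs = 0"
  by (simp add: alternator_def)

lemma nth_permute_list: "j < length xs \<Longrightarrow> permute_list \<sigma> xs ! j = xs ! \<sigma> j"
  by (simp add: permute_list_def)

lemma permute_list_comp:
  assumes "\<tau> permutes {..<n}" "length xs = n + 1"
  shows "permute_list (\<sigma> \<circ> \<tau>) xs = permute_list \<tau> (permute_list \<sigma> xs)"
proof (rule permute_list_compose)
  show "\<tau> permutes {..<length xs}" using assms by (auto intro: permutes_subset)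
qed

lemma sign_comp:
  fixes n :: nat
  assumes "\<sigma> permutes {..<n}" "\<tau> permutes {..<n}"
  shows "sign (\<sigma> \<circ> \<tau>) = sign \<sigma> * sign \<tau>"
  using assms by (intro sign_compose permutes_imp_permutation[OF finite_lessThan])

lemma sign_mult_self: "(of_int (sign \<sigma>) :: 'k) * of_int (sign \<sigma>) = 1"
  by (simp flip: of_int_mult)

text \<open>A permutation of the variables can be pulled out of an alternation as a sign, because composing with it
  only reorders the summands.\<close>

lemma alternator_permuted:
  assumes \<tau>: "\<tau> permutes {..<n}"
    and F: "\<And>xs. length xs = n + 1 \<Longrightarrow> F xs = G (permute_list \<tau> xs)"
  shows "alternator scale n F zs = of_int (sign \<tau>) *s alternator scale n G zs"
proof (cases "length zs = n + 1")
  case True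
  have "(\<Sum>\<sigma> | \<sigma> permutes {..<n}. of_int (sign \<sigma>) *s F (permute_list \<sigma> zs)) =
      (\<Sum>\<sigma> | \<sigma> permutes {..<n}. of_int (sign \<tau>) *s
        (of_int (sign (\<sigma> \<circ> \<tau>)) *s G (permute_list (\<sigma> \<circ> \<tau>) zs)))"
  proof (rule sum.cong[OF refl])
    fix \<sigma> :: "nat \<Rightarrow> nat" assume "\<sigma> \<in> {\<sigma>. \<sigma> permutes {..<n}}"
    then have \<sigma>: "\<sigma> permutes {..<n}" by simp
    have "of_int (sign \<tau>) * (of_int (sign \<sigma>) * of_int (sign \<tau>)) = (of_int (sign \<sigma>) :: 'k)"
      using sign_mult_self[of \<tau>] by (simp add: mult.left_commute)
    then show "of_int (sign \<sigma>) *s F (permute_list \<sigma> zs) = of_int (sign \<tau>) *s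
        (of_int (sign (\<sigma> \<circ> \<tau>)) *s G (permute_list (\<sigma> \<circ> \<tau>) zs))"
      using True by (simp add: F sign_comp[OF \<sigma> \<tau>] permute_list_comp[OF \<tau>])
  qed
  also have "\<dots> = of_int (sign \<tau>) *s
      (\<Sum>\<sigma> | \<sigma> permutes {..<n}. of_int (sign \<sigma>) *s G (permute_list \<sigma> zs))"
    by (subst (2) sum_permutations_compose_right[OF \<tau>]) (simp add: scale_sum_right)
  finally show ?thesis using True by (simp add: alternator_def mult.commute)
qed (simp add: alternator_outside)

lemma alternator_skew:
  assumes \<tau>: "\<tau> permutes {..<n}" and n: "length zs = n + 1"
  shows "alternator scale n F (permute_list \<tau> zs) = of_int (sign \<tau>) *s alternator scale n F zs"
proof -
  have "(\<Sum>\<sigma> | \<sigma> permutes {..<n}. of_int (sign \<sigma>) *s F (permute_list \<sigma> (permute_list \<tau> zs))) =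
      (\<Sum>\<sigma> | \<sigma> permutes {..<n}. of_int (sign \<tau>) *s
        (of_int (sign (\<tau> \<circ> \<sigma>)) *s F (permute_list (\<tau> \<circ> \<sigma>) zs)))"
  proof (rule sum.cong[OF refl])
    fix \<sigma> :: "nat \<Rightarrow> nat" assume "\<sigma> \<in> {\<sigma>. \<sigma> permutes {..<n}}"
    then have \<sigma>: "\<sigma> permutes {..<n}" by simp
    have "of_int (sign \<tau>) * (of_int (sign \<tau>) * of_int (sign \<sigma>)) = (of_int (sign \<sigma>) :: 'k)"
      using sign_mult_self[of \<tau>] by (simp flip: mult.assoc)
    then show "of_int (sign \<sigma>) *s F (permute_list \<sigma> (permute_list \<tau> zs)) = of_int (sign \<tau>) *s
        (of_int (sign (\<tau> \<circ> \<sigma>)) *s F (permute_list (\<tau> \<circ> \<sigma>) zs))"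
      by (simp add: sign_comp[OF \<tau> \<sigma>] permute_list_comp[OF \<sigma> n])
  qed
  also have "\<dots> = of_int (sign \<tau>) *s
      (\<Sum>\<sigma> | \<sigma> permutes {..<n}. of_int (sign \<sigma>) *s F (permute_list \<sigma> zs))"
    unfolding scale_sum_right
    by (rule sum.reindex_bij_witness[of _ "\<lambda>\<sigma>. inv \<tau> \<circ> \<sigma>" "\<lambda>\<sigma>. \<tau> \<circ> \<sigma>"])
      (auto simp: o_assoc permutes_inv_o[OF \<tau>] intro: permutes_compose[OF _ \<tau>]
        permutes_compose[OF _ permutes_inv[OF \<tau>]])
  finally show ?thesis using n by (simp add: alternator_def mult.commute)
qed

text \<open>Slot \<open>i\<close> of a list becomes slot \<open>inv \<sigma> i\<close> of the permuted list, so the summands of an alternation of a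
  multilinear map are multilinear again.\<close>

lemma permute_list_update:
  assumes "\<sigma> permutes {..<n}" "length xs = n + 1" "i < n + 1"
  shows "permute_list \<sigma> (xs[i := v]) = (permute_list \<sigma> xs)[inv \<sigma> i := v]" "inv \<sigma> i < n + 1"
proof -
  have \<sigma>: "\<sigma> permutes {..<length xs}" using assms by (auto intro: permutes_subset)
  show "inv \<sigma> i < n + 1"
    using permutes_in_image[OF permutes_inv[OF \<sigma>], of i] assms by simp
  show "permute_list \<sigma> (xs[i := v]) = (permute_list \<sigma> xs)[inv \<sigma> i := v]"
  proof (rule nth_equalityI)
    fix j assume j: "j < length (permute_list \<sigma> (xs[i := v]))"
    then have "\<sigma> j < length xs" using permutes_in_image[OF \<sigma>, of j] by simp
    moreover have "inv \<sigma> i = j \<longleftrightarrow> i = \<sigma> j" using permutes_inv_eq[OF \<sigma>] by metis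
    ultimately show "permute_list \<sigma> (xs[i := v]) ! j = (permute_list \<sigma> xs)[inv \<sigma> i := v] ! j"
      using j by (cases "i = \<sigma> j") (simp_all add: nth_permute_list)
  qed simp
qed

lemma alternator_cochains:
  assumes "F \<in> tensor_hom scale n"
  shows "alternator scale n F \<in> cochains scale n"
proof -
  have "F (permute_list \<sigma> (xs[i := u + v])) =
      F (permute_list \<sigma> (xs[i := u])) + F (permute_list \<sigma> (xs[i := v]))"
    and "F (permute_list \<sigma> (xs[i := c *s v])) = c *s F (permute_list \<sigma> (xs[i := v]))"
    if "\<sigma> permutes {..<n}" "length xs = n + 1" "i < n + 1" for \<sigma> xs i u v c
    using that by (simp_all add: permute_list_update[OF that, simplified]
        tensor_hom_add[OF assms] tensor_hom_scale[OF assms])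
  then have "alternator scale n F \<in> tensor_hom scale n"
    by (intro tensor_homI) (auto simp: alternator_def scale_right_distrib
      sum.distrib[symmetric] scale_sum_right mult_ac intro!: sum.cong)
  then show ?thesis by (simp add: cochains_def alternator_skew)
qed

text \<open>Adjacent transpositions generate the symmetric group, so the behaviour of \<open>f\<close> under them determines its
  behaviour under all permutations. The congruence hypothesis says that \<open>f\<close> sees a map only through its
  values on lists of length \<open>p + 1\<close>, where permuting twice is permuting by the composition.\<close>

lemma functional_permuted:
  fixes f :: "('v list \<Rightarrow> 'v) \<Rightarrow> 'v"
  assumes cong: "\<And>P P'. (\<And>xs. length xs = p + 1 \<Longrightarrow> P xs = P' xs) \<Longrightarrow> f P = f P'"
    and swap: "\<And>P a. a + 1 < p \<Longrightarrow> f (\<lambda>xs. P (permute_list (transpose a (a + 1)) xs)) = - f P"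
    and \<sigma>: "\<sigma> permutes {..<p}"
  shows "f (\<lambda>xs. P (permute_list \<sigma> xs)) = of_int (sign \<sigma>) *s f P"
proof -
  have comp: "f (\<lambda>xs. P (permute_list (\<rho> \<circ> \<tau>) xs)) = f (\<lambda>xs. P (permute_list \<tau> (permute_list \<rho> xs)))"
    if "\<tau> permutes {..<p}" for P \<rho> \<tau>
    by (rule cong) (simp add: permute_list_comp[OF that])
  have less: "f (\<lambda>xs. P (permute_list (transpose a b) xs)) = - f P" if "a < b" "b < p" for a b P
    using that
  proof (induction "b - a" arbitrary: b P)
    case (Suc d)
    show ?case
    proof (cases "b = a + 1")
      case True
      then show ?thesis using Suc.prems swap by simp
    next
      case False
      \<comment> \<open>\<open>(a b)\<close> is the conjugate of the adjacent transposition \<open>(c b)\<close> by \<open>(a c)\<close>.\<close>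
      then obtain c where c: "b = c + 1" "a < c" using Suc.prems by (cases b) auto
      have ac: "transpose a c permutes {..<p}" and cb: "transpose c b permutes {..<p}"
        using Suc.prems c by (auto intro!: permutes_swap_id)
      have IH: "f (\<lambda>xs. P (permute_list (transpose a c) xs)) = - f P" for P
        using Suc.hyps Suc.prems c by simp
      have "transpose a b = transpose a c \<circ> transpose c b \<circ> transpose a c"
        using Suc.prems c by (subst transpose_comp_triple) auto
      then have "f (\<lambda>xs. P (permute_list (transpose a b) xs)) =
          f (\<lambda>xs. P (permute_list (transpose a c) (permute_list (transpose a c \<circ> transpose c b) xs)))"
        by (simp only: comp[OF ac, of P "transpose a c \<circ> transpose c b"])
      also have "\<dots> = f (\<lambda>xs. P (permute_list (transpose a c)
          (permute_list (transpose c b) (permute_list (transpose a c) xs))))"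
        by (rule comp[OF cb])
      also have "\<dots> = - f (\<lambda>xs. P (permute_list (transpose a c) (permute_list (transpose c b) xs)))"
        by (rule IH)
      also have "f (\<lambda>xs. P (permute_list (transpose a c) (permute_list (transpose c b) xs))) =
          - f (\<lambda>xs. P (permute_list (transpose a c) xs))"
        unfolding c(1) using Suc.prems c by (intro swap) simp
      also have "f (\<lambda>xs. P (permute_list (transpose a c) xs)) = - f P"
        by (rule IH)
      finally show ?thesis by simp
    qed
  qed simp
  have transposition: "f (\<lambda>xs. P (permute_list (transpose a b) xs)) = - f P"
    if "a \<noteq> b" "a < p" "b < p" for a b P
  proof (cases "a < b")
    case True
    then show ?thesis using that by (intro less)
  next
    case False
    then have "f (\<lambda>xs. P (permute_list (transpose b a) xs)) = - f P" using that by (intro less) simp_all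
    then show ?thesis by (subst transpose_commute)
  qed
  show ?thesis
    using \<sigma> finite_lessThan
  proof (induction arbitrary: P rule: permutes_induct)
    case (swap a b \<rho>)
    have "f (\<lambda>xs. P (permute_list (transpose a b \<circ> \<rho>) xs)) =
        f (\<lambda>xs. P (permute_list \<rho> (permute_list (transpose a b) xs)))"
      by (rule comp) (rule swap)
    also have "\<dots> = - f (\<lambda>xs. P (permute_list \<rho> xs))"
      using swap by (intro transposition) simp_all
    finally have "f (\<lambda>xs. P (permute_list (transpose a b \<circ> \<rho>) xs)) = - f (\<lambda>xs. P (permute_list \<rho> xs))" .
    moreover have "sign (transpose a b \<circ> \<rho>) = - sign \<rho>"
      using swap by (subst sign_comp[of _ p]) (auto simp: sign_swap_id intro: permutes_swap_id)
    ultimately show ?case using swap.IH[of P] by (simp add: o_def)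
  qed simp_all
qed

text \<open>By linearity and \<open>functional_permuted\<close>, each of the \<open>p!\<close> summands of the alternation contributes
  \<open>f P\<close>, since the two signs cancel.\<close>

lemma functional_absorbs_alternator:
  fixes f :: "('v list \<Rightarrow> 'v) \<Rightarrow> 'v"
  assumes cong: "\<And>P P'. (\<And>xs. length xs = p + 1 \<Longrightarrow> P xs = P' xs) \<Longrightarrow> f P = f P'"
    and add: "\<And>P P'. f (P + P') = f P + f P'"
    and scale: "\<And>c P. f (fun_scale scale c P) = c *s f P"
    and swap: "\<And>P a. a + 1 < p \<Longrightarrow> f (\<lambda>xs. P (permute_list (transpose a (a + 1)) xs)) = - f P"
  shows "f (alternator scale p P) = f P"
proof -
  have "f 0 = 0" using add[of 0 0] by simp
  then have sum: "f (\<Sum>j\<in>J. F j) = (\<Sum>j\<in>J. f (F j))" for J :: "(nat \<Rightarrow> nat) set" and F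
    by (induction J rule: infinite_finite_induct) (simp_all add: add)
  have "f (alternator scale p P) = f (fun_scale scale (1 / fact p) (\<Sum>\<sigma> | \<sigma> permutes {..<p}.
      fun_scale scale (of_int (sign \<sigma>)) (\<lambda>xs. P (permute_list \<sigma> xs))))"
  proof (rule cong)
    fix xs :: "'v list" assume "length xs = p + 1"
    moreover have "(\<Sum>j\<in>J. F j) xs = (\<Sum>j\<in>J. F j xs)"
      for J :: "(nat \<Rightarrow> nat) set" and F :: "(nat \<Rightarrow> nat) \<Rightarrow> 'v list \<Rightarrow> 'v"
      by (induction J rule: infinite_finite_induct) simp_all
    ultimately show "alternator scale p P xs = fun_scale scale (1 / fact p)
        (\<Sum>\<sigma> | \<sigma> permutes {..<p}. fun_scale scale (of_int (sign \<sigma>)) (\<lambda>xs. P (permute_list \<sigma> xs))) xs"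
      by (simp add: alternator_def fun_scale_def)
  qed
  also have "\<dots> = (1 / fact p) *s (\<Sum>\<sigma> | \<sigma> permutes {..<p}. f P)"
  proof -
    have "f (\<lambda>xs. P (permute_list \<sigma> xs)) = of_int (sign \<sigma>) *s f P" if "\<sigma> permutes {..<p}" for \<sigma>
      by (rule functional_permuted[of p f, OF cong swap that])
    then show ?thesis by (simp add: sum scale sign_mult_self)
  qed
  also have "\<dots> = f P"
    by (simp add: sum_constant_scale card_permutations[OF refl])
  finally show ?thesis .
qed

lemma alternator_gerst_circ:
  "alternator scale (p + q) (gerst_circ scale p q P Q) zs =
    (\<Sum>i\<le>p. ((-1) ^ (i * q)) *s alternator scale (p + q) (\<lambda>xs. P (insert_value q Q i xs)) zs)"
proof (cases "length zs = p + q + 1")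
  case True
  have "(\<Sum>\<sigma> | \<sigma> permutes {..<p + q}. \<Sum>i\<le>p. of_int (sign \<sigma>) *s
        (((-1) ^ (i * q)) *s P (insert_value q Q i (permute_list \<sigma> zs)))) =
      (\<Sum>i\<le>p. \<Sum>\<sigma> | \<sigma> permutes {..<p + q}. of_int (sign \<sigma>) *s
        (((-1) ^ (i * q)) *s P (insert_value q Q i (permute_list \<sigma> zs))))"
    by (rule sum.swap)
  with True show ?thesis
    by (simp add: alternator_def gerst_circ_insert_value scale_sum_right mult_ac)
qed (simp add: alternator_outside)

text \<open>Exchanging two of the first \<open>q\<close> arguments of \<open>Q\<close>, inserted at position \<open>i\<close>, exchanges two of the
  variables from \<open>i\<close> to \<open>i + q - 1\<close>. As \<open>i \<le> p\<close>, these are among the first \<open>p + q\<close>, which the outer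
  alternator treats skew-symmetrically.\<close>

lemma alternator_gerst_circ_inner:
  assumes P: "P \<in> tensor_hom scale p"
  shows "alternator scale (p + q) (gerst_circ scale p q P (alternator scale q Q)) =
    alternator scale (p + q) (gerst_circ scale p q P Q)"
proof
  fix zs
  let ?f = "\<lambda>Q. alternator scale (p + q) (gerst_circ scale p q P Q) zs"
  show "?f (alternator scale q Q) = ?f Q"
  proof (rule functional_absorbs_alternator[where f = ?f])
    fix Q Q' :: "'v list \<Rightarrow> 'v"
    assume eq: "\<And>xs. length xs = q + 1 \<Longrightarrow> Q xs = Q' xs"
    have "gerst_circ scale p q P Q = gerst_circ scale p q P Q'"
      by (auto simp: gerst_circ_insert_value insert_value_def eq fun_eq_iff intro!: sum.cong)
    then show "?f Q = ?f Q'" by simp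
  next
    fix Q a assume a: "a + 1 < q"
    let ?\<tau> = "\<lambda>i. transpose (a + i) (a + i + 1)"
    have "alternator scale (p + q)
        (\<lambda>xs. P (insert_value q (\<lambda>xs. Q (permute_list (transpose a (a + 1)) xs)) i xs)) zs =
        - alternator scale (p + q) (\<lambda>xs. P (insert_value q Q i xs)) zs" if "i \<le> p" for i
    proof -
      have "insert_value q (\<lambda>xs. Q (permute_list (transpose a (a + 1)) xs)) i xs =
          insert_value q Q i (permute_list (?\<tau> i) xs)" if n: "length xs = p + q + 1" for xs
      proof -
        have "permute_list (transpose a (a + 1)) (take (q + 1) (drop i xs)) =
            take (q + 1) (drop i (permute_list (?\<tau> i) xs))"
          using n a \<open>i \<le> p\<close>
          by (auto simp: nth_permute_list transpose_def ac_simps intro!: nth_equalityI)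
        then show ?thesis
          using n a \<open>i \<le> p\<close>
          by (auto simp: nth_permute_list transpose_def nth_insert_value length_insert_value
            intro!: nth_equalityI)
      qed
      then show ?thesis
        using a \<open>i \<le> p\<close> by (subst alternator_permuted[where \<tau> = "?\<tau> i"
            and G = "\<lambda>xs. P (insert_value q Q i xs)"])
          (auto intro: permutes_swap_id simp: sign_swap_id)
    qed
    then show "?f (\<lambda>xs. Q (permute_list (transpose a (a + 1)) xs)) = - ?f Q"
      by (simp add: alternator_gerst_circ sum_negf)
  qed (simp_all add: gerst_circ_add_right[OF P] gerst_circ_scale_right[OF P]
      alternator_add alternator_scale fun_scale_apply)
qed

text \<open>The cycle by which \<open>permute_list\<close> moves the entry at position \<open>a + m\<close> to position \<open>a\<close>, shifting the \<open>m\<close>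
  entries before it one place to the right.\<close>
definition rotation :: "nat \<Rightarrow> nat \<Rightarrow> nat \<Rightarrow> nat" where
  "rotation a m j = (if j = a then a + m else if a < j \<and> j \<le> a + m then j - 1 else j)"

lemma rotation_Suc: "rotation a (Suc m) = transpose (a + m) (a + m + 1) \<circ> rotation a m"
  by (auto simp: rotation_def transpose_def fun_eq_iff)

lemma rotation_permutes: "a + m < n \<Longrightarrow> rotation a m permutes {..<n}"
proof (induction m)
  case 0
  have "rotation a 0 = id" by (auto simp: rotation_def fun_eq_iff)
  then show ?case by (simp only: permutes_id)
next
  case (Suc m)
  then show ?case unfolding rotation_Suc by (intro permutes_compose permutes_swap_id) auto
qed

lemma sign_rotation: "sign (rotation a m) = (-1) ^ m"
proof (induction m)
  case 0
  have "rotation a 0 = id" by (auto simp: rotation_def fun_eq_iff)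
  then show ?case by simp
next
  case (Suc m)
  have "sign (rotation a (Suc m)) = sign (transpose (a + m) (a + m + 1)) * sign (rotation a m)"
    unfolding rotation_Suc
    by (rule sign_comp[of _ "a + m + 2"]) (auto intro: permutes_swap_id rotation_permutes)
  then show ?case using Suc by (simp add: sign_swap_id)
qed

text \<open>Exchanging the inserted value with the argument after it moves one variable past the whole block of \<open>q + 1\<close>
  arguments of \<open>Q\<close>.\<close>

lemma permute_insert_value_slot:
  assumes "a + q + 1 < length xs"
  shows "permute_list (transpose a (Suc a)) (insert_value q Q a xs) =
    insert_value q Q (Suc a) (permute_list (rotation a (Suc q)) xs)"
proof -
  have "take (q + 1) (drop (Suc a) (permute_list (rotation a (Suc q)) xs)) = take (q + 1) (drop a xs)"
    using assms by (auto simp: nth_permute_list rotation_def intro!: nth_equalityI)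
  then show ?thesis
    using assms by (auto simp: nth_permute_list transpose_def rotation_def nth_insert_value
      length_insert_value intro!: nth_equalityI)
qed

lemma permute_insert_value_left:
  assumes "a + 1 < i" "i + q < length xs"
  shows "permute_list (transpose a (Suc a)) (insert_value q Q i xs) =
    insert_value q Q i (permute_list (transpose a (Suc a)) xs)"
proof -
  have "take (q + 1) (drop i (permute_list (transpose a (Suc a)) xs)) = take (q + 1) (drop i xs)"
    using assms by (auto simp: nth_permute_list transpose_def intro!: nth_equalityI)
  then show ?thesis
    using assms by (auto simp: nth_permute_list transpose_def nth_insert_value
      length_insert_value intro!: nth_equalityI)
qed

lemma permute_insert_value_right:
  assumes "i < a" "a + q + 1 < length xs"
  shows "permute_list (transpose a (Suc a)) (insert_value q Q i xs) =
    insert_value q Q i (permute_list (transpose (a + q) (Suc (a + q))) xs)"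
proof -
  have "take (q + 1) (drop i (permute_list (transpose (a + q) (Suc (a + q))) xs)) =
      take (q + 1) (drop i xs)"
    using assms by (auto simp: nth_permute_list transpose_def intro!: nth_equalityI)
  then show ?thesis
    using assms by (auto simp: nth_permute_list transpose_def nth_insert_value
      length_insert_value intro!: nth_equalityI)
qed

text \<open>Let \<open>P'\<close> arise from \<open>P\<close> by exchanging the arguments \<open>a\<close> and \<open>a + 1\<close>. The terms of \<open>\<alpha> (P' \<circ> Q)\<close> with \<open>Q\<close> in
  neither of the two positions are minus the corresponding terms of \<open>\<alpha> (P \<circ> Q)\<close>. The other two terms are
  interchanged with the sign \<open>(-1) ^ (q + 1)\<close> of a rotation, while their coefficients \<open>(-1) ^ (i * q)\<close>
  differ by \<open>(-1) ^ q\<close>, which again makes \<open>-1\<close> in total.\<close>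

lemma alternator_gerst_circ_outer:
  "alternator scale (p + q) (gerst_circ scale p q (alternator scale p P) Q) =
    alternator scale (p + q) (gerst_circ scale p q P Q)"
proof
  fix zs
  let ?f = "\<lambda>P. alternator scale (p + q) (gerst_circ scale p q P Q) zs"
  show "?f (alternator scale p P) = ?f P"
  proof (rule functional_absorbs_alternator[where f = ?f])
    fix P P' :: "'v list \<Rightarrow> 'v"
    assume eq: "\<And>xs. length xs = p + 1 \<Longrightarrow> P xs = P' xs"
    have "gerst_circ scale p q P Q = gerst_circ scale p q P' Q"
      by (auto simp: gerst_circ_insert_value length_insert_value eq fun_eq_iff intro!: sum.cong)
    then show "?f P = ?f P'" by simp
  next
    fix P a assume a: "a + 1 < p"
    let ?\<tau> = "transpose a (a + 1)"
    let ?A = "\<lambda>P i. alternator scale (p + q) (\<lambda>xs. P (insert_value q Q i xs)) zs"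
    let ?T = "\<lambda>P i. ((-1) ^ (i * q)) *s ?A P i"
    have rotate: "?A (\<lambda>xs. P (permute_list ?\<tau> xs)) a = ((-1) ^ (q + 1)) *s ?A P (a + 1)" for P
      using a by (subst alternator_permuted[where \<tau> = "rotation a (q + 1)"
          and G = "\<lambda>xs. P (insert_value q Q (a + 1) xs)"])
        (auto intro: rotation_permutes simp: sign_rotation permute_insert_value_slot)
    have slot: "?T (\<lambda>xs. P (permute_list ?\<tau> xs)) a = - ?T P (a + 1)"
      by (subst rotate) (simp add: power_add)
    \<comment> \<open>The exchange is an involution, so the case \<open>i = a + 1\<close> is the case \<open>i = a\<close> for the exchanged map.\<close>
    have \<tau>: "?\<tau> permutes {..<p}" using a by (intro permutes_swap_id) auto
    have "permute_list ?\<tau> (permute_list ?\<tau> ys) = ys" if "length ys = p + 1" for ys :: "'v list"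
      using permute_list_comp[OF \<tau> that, of ?\<tau>] by simp
    then have "?A P a = ?A (\<lambda>xs. P (permute_list ?\<tau> (permute_list ?\<tau> xs))) a"
      using a by (intro fun_cong[OF alternator_cong]) (simp add: length_insert_value)
    also have "\<dots> = ((-1) ^ (q + 1)) *s ?A (\<lambda>xs. P (permute_list ?\<tau> xs)) (a + 1)"
      by (rule rotate)
    finally have slot': "?T (\<lambda>xs. P (permute_list ?\<tau> xs)) (a + 1) = - ?T P a"
      by (simp add: power_add)
    have other: "?T (\<lambda>xs. P (permute_list ?\<tau> xs)) i = - ?T P i"
      if "i \<le> p" "i \<noteq> a" "i \<noteq> a + 1" for i
    proof (cases "i < a")
      case True
      then show ?thesis
        using a that by (subst alternator_permuted[where \<tau> = "transpose (a + q) (a + q + 1)"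
            and G = "\<lambda>xs. P (insert_value q Q i xs)"])
          (auto intro: permutes_swap_id simp: sign_swap_id permute_insert_value_right)
    next
      case False
      then show ?thesis
        using a that by (subst alternator_permuted[where \<tau> = "?\<tau>"
            and G = "\<lambda>xs. P (insert_value q Q i xs)"])
          (auto intro: permutes_swap_id simp: sign_swap_id permute_insert_value_left)
    qed
    have split: "(\<Sum>i\<le>p. g i) = g a + g (a + 1) + (\<Sum>i\<in>{..p} - {a, a + 1}. g i)"
      for g :: "nat \<Rightarrow> 'v"
      using a by (subst sum.subset_diff[of "{a, a + 1}"]) auto
    show "?f (\<lambda>xs. P (permute_list ?\<tau> xs)) = - ?f P"
      unfolding alternator_gerst_circ split slot slot' using other by (simp add: sum_negf)
  qed (simp_all add: gerst_circ_add_left gerst_circ_scale_left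
      alternator_add alternator_scale fun_scale_apply)
qed

section \<open>The graded Lie algebra of cochains\<close>

lemma fun_scale_fun_scale: "fun_scale scale a (fun_scale scale b F) = fun_scale scale (a * b) F"
  by (simp add: fun_scale_def)

lemma fun_scale_add: "fun_scale scale a (F + G) = fun_scale scale a F + fun_scale scale a G"
  by (simp add: fun_scale_def scale_right_distrib fun_eq_iff)

lemma fun_scale_diff: "fun_scale scale a (F - G) = fun_scale scale a F - fun_scale scale a G"
  by (simp add: fun_scale_def scale_right_diff_distrib fun_eq_iff)

sublocale pointwise: vector_space "fun_scale scale"
  by unfold_locales (simp_all add: fun_scale_def fun_eq_iff scale_right_distrib scale_left_distrib)

lemma alternator_diff:
  "alternator scale n (F - G) = alternator scale n F - alternator scale n G"
  using alternator_add[of n "F - G" G] by simp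

lemma cochains_tensor_hom: "P \<in> cochains scale p \<Longrightarrow> P \<in> tensor_hom scale p"
  by (simp add: cochains_def)

lemma subspace_cochains: "pointwise.subspace (cochains scale p)"
proof (rule pointwise.subspaceI)
  show "0 \<in> cochains scale p" by (simp add: cochains_def tensor_hom_zero)
qed (auto simp: cochains_def tensor_hom_plus tensor_hom_fun_scale scale_right_distrib fun_scale_apply
  mult.commute)

lemma component_zero: "component p 0 = (0 :: 'v list \<Rightarrow> 'v)"
  by (simp add: component_def fun_eq_iff)

lemma component_add:
  fixes P Q :: "'v list \<Rightarrow> 'v"
  shows "component p (P + Q) = component p P + component p Q"
  by (simp add: component_def fun_eq_iff)

lemma component_fun_scale: "component p (fun_scale scale c P) = fun_scale scale c (component p P)"
  by (simp add: component_def fun_scale_def fun_eq_iff)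

sublocale cochain_grading: graded_vector_space "fun_scale scale" "cochains scale"
proof unfold_locales
  show "pointwise.subspace (cochains scale p)" for p by (rule subspace_cochains)
next
  fix I :: "nat set" and x p
  assume I: "finite I" "\<And>p. p \<in> I \<Longrightarrow> x p \<in> cochains scale p" "(\<Sum>p\<in>I. x p) = 0" "p \<in> I"
  have "component p (\<Sum>r\<in>J. x r) = (\<Sum>r\<in>J. component p (x r))" for J
    by (induction J rule: infinite_finite_induct) 
      (simp_all only: component_add component_zero sum.infinite sum.empty sum.insert not_False_eq_True)
  then have "(\<Sum>r\<in>I. component p (x r)) = component p 0" using I by metis
  moreover have "(\<Sum>r\<in>I. component p (x r)) = (\<Sum>r\<in>I. if r = p then x p else 0)"
    by (intro sum.cong refl) (auto simp: component_homogeneous[OF cochains_tensor_hom[OF I(2)]])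
  ultimately show "x p = 0" using I(1,4) by (simp add: component_zero)
qed

text \<open>The elements of the direct sum are described only as a span; this recovers their finitely many
  homogeneous components, on which the bracket is defined.\<close>

lemma cochain_total_components:
  assumes "P \<in> cochain_grading.total"
  shows "finite {p. component p P \<noteq> 0}" "component p P \<in> cochains scale p"
proof -
  let ?T = "{P. finite {p. component p P \<noteq> 0} \<and> (\<forall>p. component p P \<in> cochains scale p)}"
  have "pointwise.span (\<Union>p. cochains scale p) \<subseteq> ?T"
  proof (rule pointwise.span_minimal)
    show "(\<Union>p. cochains scale p) \<subseteq> ?T"
      by (auto simp: component_homogeneous[OF cochains_tensor_hom] pointwise.subspace_0[OF subspace_cochains])
    show "pointwise.subspace ?T"
    proof (rule pointwise.subspaceI)
      show "0 \<in> ?T" by (simp add: component_zero pointwise.subspace_0[OF subspace_cochains])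
    next
      fix P Q assume PQ: "P \<in> ?T" "Q \<in> ?T"
      then have "finite ({p. component p P \<noteq> 0} \<union> {p. component p Q \<noteq> 0})" by simp
      then have "finite {p. component p (P + Q) \<noteq> 0}"
        by (rule rev_finite_subset) (auto simp: component_add)
      then show "P + Q \<in> ?T"
        using PQ by (simp add: component_add pointwise.subspace_add[OF subspace_cochains])
    next
      fix c P assume P: "P \<in> ?T"
      then have "finite {p. component p P \<noteq> 0}" by simp
      then have "finite {p. component p (fun_scale scale c P) \<noteq> 0}"
        by (rule rev_finite_subset) (auto simp: component_fun_scale)
      then show "fun_scale scale c P \<in> ?T"
        using P by (simp add: component_fun_scale pointwise.subspace_scale[OF subspace_cochains])
    qed
  qed
  with assms show "finite {p. component p P \<noteq> 0}" "component p P \<in> cochains scale p"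
    unfolding cochain_grading.total_def by auto
qed

lemma gerst_bracket_tensor_hom:
  assumes "P \<in> tensor_hom scale p" "Q \<in> tensor_hom scale q"
  shows "gerst_bracket scale p q P Q \<in> tensor_hom scale (p + q)"
  unfolding gerst_bracket_def
  using gerst_circ_tensor_hom[OF assms] gerst_circ_tensor_hom[OF assms(2,1)]
  by (simp add: tensor_hom_minus tensor_hom_fun_scale add.commute)

lemma gerst_bracket_skew:
  "gerst_bracket scale p q P Q = - fun_scale scale ((-1) ^ (p * q)) (gerst_bracket scale q p Q P)"
  by (simp add: gerst_bracket_def fun_scale_sign mult.commute)

lemma gerst_bracket_left_linear:
  assumes "Q \<in> tensor_hom scale q"
  shows "gerst_bracket scale p q (P + P') Q = gerst_bracket scale p q P Q + gerst_bracket scale p q P' Q"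
    and "gerst_bracket scale p q (fun_scale scale c P) Q = fun_scale scale c (gerst_bracket scale p q P Q)"
  by (simp_all add: gerst_bracket_def gerst_circ_add_left gerst_circ_add_right[OF assms]
      gerst_circ_scale_left gerst_circ_scale_right[OF assms] fun_scale_add fun_scale_diff
      fun_scale_fun_scale mult.commute)

lemma gerst_bracket_right_linear:
  assumes "P \<in> tensor_hom scale p"
  shows "gerst_bracket scale p q P (Q + Q') = gerst_bracket scale p q P Q + gerst_bracket scale p q P Q'"
    and "gerst_bracket scale p q P (fun_scale scale c Q) = fun_scale scale c (gerst_bracket scale p q P Q)"
  by (simp_all add: gerst_bracket_def gerst_circ_add_left gerst_circ_add_right[OF assms]
      gerst_circ_scale_left gerst_circ_scale_right[OF assms] fun_scale_add fun_scale_diff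
      fun_scale_fun_scale mult.commute)

lemma alternator_gerst_bracket_right:
  assumes "P \<in> tensor_hom scale p"
  shows "alternator scale (p + q) (gerst_bracket scale p q P (alternator scale q Q)) =
    alternator scale (p + q) (gerst_bracket scale p q P Q)"
  using alternator_gerst_circ_outer[of q p Q P]
  by (simp add: gerst_bracket_def alternator_diff alternator_scale
      alternator_gerst_circ_inner[OF assms] add.commute)

lemma alternator_gerst_bracket_left:
  assumes "Q \<in> tensor_hom scale q"
  shows "alternator scale (p + q) (gerst_bracket scale p q (alternator scale p P) Q) =
    alternator scale (p + q) (gerst_bracket scale p q P Q)"
  using alternator_gerst_circ_inner[OF assms, of p P]
  by (simp add: gerst_bracket_def alternator_diff alternator_scale
      alternator_gerst_circ_outer add.commute)

lemma homog_bracket_cochains: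
  assumes "P \<in> tensor_hom scale p" "Q \<in> tensor_hom scale q"
  shows "homog_bracket scale p q P Q \<in> cochains scale (p + q)"
  unfolding homog_bracket_def
  by (intro pointwise.subspace_scale[OF subspace_cochains] alternator_cochains
      gerst_bracket_tensor_hom assms)

lemma homog_bracket_skew:
  "homog_bracket scale p q P Q = - fun_scale scale ((-1) ^ (p * q)) (homog_bracket scale q p Q P)"
proof -
  have "gerst_bracket scale p q P Q =
      fun_scale scale (- ((-1) ^ (p * q))) (gerst_bracket scale q p Q P)"
    by (subst gerst_bracket_skew) simp
  then show ?thesis
    by (simp only: homog_bracket_def alternator_scale fun_scale_fun_scale)
      (simp add: mult_ac add.commute)
qed

lemma homog_bracket_left_linear:
  assumes "Q \<in> tensor_hom scale q"
  shows "homog_bracket scale p q (P + P') Q = homog_bracket scale p q P Q + homog_bracket scale p q P' Q"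
    and "homog_bracket scale p q (fun_scale scale c P) Q = fun_scale scale c (homog_bracket scale p q P Q)"
  by (simp_all add: homog_bracket_def gerst_bracket_left_linear[OF assms] alternator_add
      alternator_scale fun_scale_add fun_scale_fun_scale mult.commute)

lemma homog_bracket_right_linear:
  assumes "P \<in> tensor_hom scale p"
  shows "homog_bracket scale p q P (Q + Q') = homog_bracket scale p q P Q + homog_bracket scale p q P Q'"
    and "homog_bracket scale p q P (fun_scale scale c Q) = fun_scale scale c (homog_bracket scale p q P Q)"
  by (simp_all add: homog_bracket_def gerst_bracket_right_linear[OF assms] alternator_add
      alternator_scale fun_scale_add fun_scale_fun_scale mult.commute)

text \<open>The inner alternator is absorbed by the outer one, and the factor \<open>(q + r)!\<close> of the inner bracket
  cancels against the outer denominator. What remains is symmetric in the three degrees.\<close>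

lemma homog_bracket_nested_right:
  assumes "P \<in> tensor_hom scale p"
  shows "homog_bracket scale p (q + r) P (homog_bracket scale q r Q R) =
    fun_scale scale (fact (p + q + r) / (fact p * fact q * fact r))
      (alternator scale (p + q + r) (gerst_bracket scale p (q + r) P (gerst_bracket scale q r Q R)))"
  using alternator_gerst_bracket_right[OF assms, of "q + r"]
  by (simp add: homog_bracket_def gerst_bracket_right_linear[OF assms] alternator_scale
      fun_scale_fun_scale add.assoc mult.assoc)

lemma homog_bracket_nested_left:
  assumes "R \<in> tensor_hom scale r"
  shows "homog_bracket scale (p + q) r (homog_bracket scale p q P Q) R =
    fun_scale scale (fact (p + q + r) / (fact p * fact q * fact r))
      (alternator scale (p + q + r) (gerst_bracket scale (p + q) r (gerst_bracket scale p q P Q) R))"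
  using alternator_gerst_bracket_left[OF assms, of "p + q"]
  by (simp add: homog_bracket_def gerst_bracket_left_linear[OF assms] alternator_scale
      fun_scale_fun_scale mult.assoc)

lemma homog_bracket_jacobi:
  assumes P: "P \<in> tensor_hom scale p" and Q: "Q \<in> tensor_hom scale q"
    and R: "R \<in> tensor_hom scale r"
  shows "homog_bracket scale p (q + r) P (homog_bracket scale q r Q R) =
    homog_bracket scale (p + q) r (homog_bracket scale p q P Q) R
    + fun_scale scale ((-1) ^ (p * q))
        (homog_bracket scale q (p + r) Q (homog_bracket scale p r P R))"
proof -
  have swap: "q + p + r = p + q + r" by simp
  show ?thesis
    unfolding homog_bracket_nested_right[OF P] homog_bracket_nested_right[OF Q]
      homog_bracket_nested_left[OF R] gerst_bracket_jacobi[OF assms]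
    by (simp add: alternator_add alternator_scale fun_scale_add fun_scale_fun_scale mult_ac swap)
qed

text \<open>The index sets in the definition of the bracket depend on its arguments. Replacing them by common larger
  finite sets makes bilinearity a term by term statement.\<close>

lemma bracketC_eq_sum:
  assumes P: "\<And>p. component p P \<in> cochains scale p" and Q: "\<And>q. component q Q \<in> cochains scale q"
    and I: "finite I" "{p. component p P \<noteq> 0} \<subseteq> I" and J: "finite J" "{q. component q Q \<noteq> 0} \<subseteq> J"
  shows "bracketC scale P Q =
    (\<Sum>p\<in>I. \<Sum>q\<in>J. homog_bracket scale p q (component p P) (component q Q))"
proof -
  have left0: "homog_bracket scale p q 0 (component q Q) = 0" for p q
    using homog_bracket_left_linear(2)[OF cochains_tensor_hom[OF Q], of p q 0 0] by simp
  have right0: "homog_bracket scale p q (component p P) 0 = 0" for p q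
    using homog_bracket_right_linear(2)[OF cochains_tensor_hom[OF P], of p q 0 0] by simp
  have "bracketC scale P Q = (\<Sum>p | component p P \<noteq> 0. \<Sum>q\<in>J.
      homog_bracket scale p q (component p P) (component q Q))"
    unfolding bracketC_def by (intro sum.cong refl sum.mono_neutral_left J) (auto simp: right0)
  also have "\<dots> = (\<Sum>p\<in>I. \<Sum>q\<in>J. homog_bracket scale p q (component p P) (component q Q))"
    by (intro sum.mono_neutral_left I) (auto simp: left0)
  finally show ?thesis .
qed

theorem graded_lie_algebra_cochains:
  "graded_lie_algebra (fun_scale scale) (cochains scale) (bracketC scale)"
proof unfold_locales
  note total = cochain_total_components
  note hom = cochains_tensor_hom[OF total(2)]
  fix P Q R assume P: "P \<in> cochain_grading.total" and Q: "Q \<in> cochain_grading.total"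
    and R: "R \<in> cochain_grading.total"
  have PQ: "P + Q \<in> cochain_grading.total" and QR: "Q + R \<in> cochain_grading.total"
    using P Q R by (auto simp: cochain_grading.total_def pointwise.span_add)
  let ?I = "{p. component p P \<noteq> 0} \<union> {p. component p Q \<noteq> 0}
    \<union> {p. component p R \<noteq> 0}"
  have I: "finite ?I" using total(1)[OF P] total(1)[OF Q] total(1)[OF R] by simp
  have eq: "bracketC scale F G =
      (\<Sum>p\<in>?I. \<Sum>q\<in>?I. homog_bracket scale p q (component p F) (component q G))"
    if "F \<in> cochain_grading.total" "G \<in> cochain_grading.total"
      "{p. component p F \<noteq> 0} \<subseteq> ?I" "{p. component p G \<noteq> 0} \<subseteq> ?I" for F G
    by (rule bracketC_eq_sum[OF total(2)[OF that(1)] total(2)[OF that(2)] I that(3) I that(4)])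
  have sub: "{p. component p (P + Q) \<noteq> 0} \<subseteq> ?I" "{p. component p (Q + R) \<noteq> 0} \<subseteq> ?I"
    by (auto simp: component_add)
  show "bracketC scale (P + Q) R = bracketC scale P R + bracketC scale Q R"
    by (subst (1 2 3) eq) (use P Q R PQ sub in \<open>auto simp: component_add
      homog_bracket_left_linear[OF hom] sum.distrib\<close>)
  show "bracketC scale P (Q + R) = bracketC scale P Q + bracketC scale P R"
    by (subst (1 2 3) eq) (use P Q R QR sub in \<open>auto simp: component_add
      homog_bracket_right_linear[OF hom] sum.distrib\<close>)
next
  note total = cochain_total_components
  note hom = cochains_tensor_hom[OF total(2)]
  fix P R c assume P: "P \<in> cochain_grading.total" and R: "R \<in> cochain_grading.total"
  have cP: "fun_scale scale c P \<in> cochain_grading.total"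
    and cR: "fun_scale scale c R \<in> cochain_grading.total"
    using P R by (auto simp: cochain_grading.total_def pointwise.span_scale)
  let ?I = "{p. component p P \<noteq> 0} \<union> {p. component p R \<noteq> 0}"
  have I: "finite ?I" using total(1)[OF P] total(1)[OF R] by simp
  have eq: "bracketC scale F G =
      (\<Sum>p\<in>?I. \<Sum>q\<in>?I. homog_bracket scale p q (component p F) (component q G))"
    if "F \<in> cochain_grading.total" "G \<in> cochain_grading.total"
      "{p. component p F \<noteq> 0} \<subseteq> ?I" "{p. component p G \<noteq> 0} \<subseteq> ?I" for F G
    by (rule bracketC_eq_sum[OF total(2)[OF that(1)] total(2)[OF that(2)] I that(3) I that(4)])
  have sub: "{p. component p (fun_scale scale c P) \<noteq> 0} \<subseteq> ?I"
    "{p. component p (fun_scale scale c R) \<noteq> 0} \<subseteq> ?I"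
    by (auto simp: component_fun_scale)
  show "bracketC scale (fun_scale scale c P) R = fun_scale scale c (bracketC scale P R)"
    by (subst (1 2) eq) (use P R cP sub in \<open>auto simp: component_fun_scale
      homog_bracket_left_linear[OF hom] pointwise.scale_sum_right\<close>)
  show "bracketC scale P (fun_scale scale c R) = fun_scale scale c (bracketC scale P R)"
    by (subst (1 2) eq) (use P R cR sub in \<open>auto simp: component_fun_scale
      homog_bracket_right_linear[OF hom] pointwise.scale_sum_right\<close>)
next
  note homog = bracketC_homogeneous[OF vector_space_axioms]
  fix P Q p q assume P: "P \<in> cochains scale p" and Q: "Q \<in> cochains scale q"
  have PQ: "homog_bracket scale p q P Q \<in> cochains scale (p + q)"
    if "P \<in> cochains scale p" "Q \<in> cochains scale q" for P Q p q
    using that by (intro homog_bracket_cochains cochains_tensor_hom)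
  show "bracketC scale P Q \<in> cochains scale (p + q)"
    using PQ[OF P Q] by (simp add: homog[OF P Q])
  show "bracketC scale P Q = - fun_scale scale ((- 1) ^ (p * q)) (bracketC scale Q P)"
    unfolding homog[OF P Q] homog[OF Q P] by (rule homog_bracket_skew)
  fix R r assume R: "R \<in> cochains scale r"
  show "bracketC scale P (bracketC scale Q R) = bracketC scale (bracketC scale P Q) R
      + fun_scale scale ((- 1) ^ (p * q)) (bracketC scale Q (bracketC scale P R))"
    unfolding homog[OF Q R] homog[OF P Q] homog[OF P R] homog[OF P PQ[OF Q R]]
      homog[OF PQ[OF P Q] R] homog[OF Q PQ[OF P R]]
    by (intro homog_bracket_jacobi cochains_tensor_hom P Q R)
qed

section \<open>Pre-Lie products as Maurer-Cartan elements\<close>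

lemma tensor_hom_one_eq_cochains: "tensor_hom scale 1 = cochains scale 1"
proof -
  have "\<sigma> = id" if "\<sigma> permutes {..<1::nat}" for \<sigma>
    using that by (simp add: lessThan_Suc)
  then have "x (permute_list \<sigma> xs) = of_int (sign \<sigma>) *s x xs" if "\<sigma> permutes {..<1}"
    for x :: "'v list \<Rightarrow> 'v" and \<sigma> xs using that by fastforce
  then show ?thesis unfolding cochains_def by blast
qed

lemma permutations_lessThan_2: "{\<sigma>. \<sigma> permutes {..<2::nat}} = {id, transpose 0 1}"
proof -
  have "{..<2::nat} = {0, 1}" by auto
  then show ?thesis by (auto simp: permutes_doubleton_iff)
qed

text \<open>The factor \<open>2\<close> is the product of \<open>2! / (1! 1!)\<close>, of the \<open>1 / 2!\<close> of the alternator, and of the \<open>2\<close> in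
  \<open>[\<pi>, \<pi>] = 2 (\<pi> \<circ> \<pi>)\<close>, which holds because \<open>\<pi>\<close> has odd degree.\<close>

lemma homog_bracket_self_degree_one:
  "homog_bracket scale 1 1 \<pi> \<pi> [x, y, z] = 2 *s
    ((\<pi> [\<pi> [x, y], z] - \<pi> [x, \<pi> [y, z]]) - (\<pi> [\<pi> [y, x], z] - \<pi> [y, \<pi> [x, z]]))"
proof -
  have G: "gerst_bracket scale 1 1 \<pi> \<pi> [x, y, z] = 2 *s (\<pi> [\<pi> [x, y], z] - \<pi> [x, \<pi> [y, z]])"
    for x y z
    by (simp add: gerst_bracket_def fun_scale_def gerst_circ_def scale_right_distrib
      scale_left_distrib[of 1 1, simplified])
  have "permute_list (transpose 0 1) [x, y, z] = [y, x, z]"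
    by (simp add: permute_list_def transpose_def)
  moreover have "id \<noteq> transpose (0::nat) 1" by (metis id_apply transpose_apply_first zero_neq_one)
  moreover have "alternator scale (1 + 1) F [x, y, z] = (1 / 2) *s
    (\<Sum>\<sigma>\<in>{id, transpose 0 1}. of_int (sign \<sigma>) *s F (permute_list \<sigma> [x, y, z]))" for F
    using permutations_lessThan_2 by (simp add: alternator_def numeral_2_eq_2)
  ultimately show ?thesis
    by (simp add: homog_bracket_def fun_scale_def G sign_swap_id scale_right_diff_distrib
      del: One_nat_def)
qed

theorem pre_lie_iff_bracket_self_zero:
  assumes \<pi>: "\<pi> \<in> tensor_hom scale 1"
  shows "pre_lie_algebra scale (\<lambda>x y. \<pi> [x, y]) \<longleftrightarrow> bracketC scale \<pi> \<pi> = 0"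
proof -
  have C: "\<pi> \<in> cochains scale 1" using \<pi> tensor_hom_one_eq_cochains by simp
  have B: "bracketC scale \<pi> \<pi> = homog_bracket scale 1 1 \<pi> \<pi>"
    by (rule bracketC_homogeneous[OF vector_space_axioms C C])
  have "homog_bracket scale 1 1 \<pi> \<pi> xs = 0" if "length xs \<noteq> 3" for xs
    using that by (simp add: homog_bracket_def fun_scale_def alternator_def)
  moreover have "\<exists>x y z. xs = [x, y, z]" if "length xs = 3" for xs :: "'v list"
    using that by (auto simp: numeral_3_eq_3 length_Suc_conv)
  ultimately have "bracketC scale \<pi> \<pi> = 0 \<longleftrightarrow>
      (\<forall>x y z. homog_bracket scale 1 1 \<pi> \<pi> [x, y, z] = 0)"
    unfolding B fun_eq_iff by (metis zero_fun_apply)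
  also have "\<dots> \<longleftrightarrow> (\<forall>x y z. \<pi> [\<pi> [x, y], z] - \<pi> [x, \<pi> [y, z]] =
      \<pi> [\<pi> [y, x], z] - \<pi> [y, \<pi> [x, z]])"
    by (simp only: homog_bracket_self_degree_one) simp
  also have "\<dots> \<longleftrightarrow> pre_lie_algebra scale (\<lambda>x y. \<pi> [x, y])"
  proof -
    have lin: "Vector_Spaces.linear scale scale (\<lambda>v. \<pi> (xs[i := v]))"
      if "i < 1 + 1" "length xs = 1 + 1" for xs i
      using \<pi> that unfolding tensor_hom_def by blast
    have "Vector_Spaces.linear scale scale (\<lambda>v. \<pi> [v, y])" "Vector_Spaces.linear scale scale (\<lambda>v. \<pi> [x, v])"
      for x y using lin[of 0 "[0, y]"] lin[of 1 "[x, 0]"] by simp_all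
    then show ?thesis
      by (simp add: pre_lie_algebra_def pre_lie_algebra_axioms_def vector_space_axioms)
  qed
  finally show ?thesis by simp
qed

end

theorem theorem3p1:
  fixes scale :: "'k::{alg_closed_field, field_char_0} \<Rightarrow> 'v::ab_group_add \<Rightarrow> 'v"
    and Basis :: "'v set"
  assumes "finite_dimensional_vector_space scale Basis"
  shows "graded_lie_algebra (fun_scale scale) (cochains scale) (bracketC scale) \<and>
    tensor_hom scale 1 = cochains scale 1 \<and>
    (\<forall>\<pi> \<in> tensor_hom scale 1.
       pre_lie_algebra scale (\<lambda>x y. \<pi> [x, y]) \<longleftrightarrow> bracketC scale \<pi> \<pi> = 0)"
proof -
  interpret finite_dimensional_vector_space scale Basis by fact
  interpret char0_vector_space scale by unfold_locales
  show ?thesis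
    using graded_lie_algebra_cochains tensor_hom_one_eq_cochains pre_lie_iff_bracket_self_zero
    by blast
qed

end
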